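(* Let $n\ge 3$ be an odd integer and let $U\subset\mathbb{R}^n$ be an open set with $\overline{U}\subset\mathbb{B}$. There exists a non-trivial (i.e. not identically zero) function $f\in C_c^\infty(\mathbb{B})$ such that $f|_U=0$ and $\mathcal{R}f$ vanishes on all spheres passing through $U$; that is, $\mathcal{R}f(p,t)=0$ for every $p\in\mathbb{S}^{n-1}$ and $t>0$ such that $\{x\in\mathbb{R}^n:|x-p|=t\}\cap U\neq\emptyset$.
   Context: $\mathbb{B}$ is the (open) unit ball in $\mathbb{R}^n$ and $\mathbb{S}^{n-1}$ its boundary; $\omega_n$ is the surface area of $\mathbb{S}^{n-1}$ and $\mathrm dS$ its surface measure. For $f\in C_c^\infty(\mathbb{B})$ (extended by zero to $\mathbb{R}^n$), the spherical mean transform is $$\mathcal{R}f(p,t)=\frac1{\omega_n}\int_{\mathbb{S}^{n-1}} f(p+t\theta)\,\mathrm dS(\theta),\qquad p\in\mathbb{S}^{n-1},\ t\in(0,\infty).$$ *)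

theory Defs
  imports "HOL-Analysis.Analysis"
begin

text \<open>Smoothness by iterated directional derivatives. As every \<^term>\<open>Ck_on k\<close> with \<^term>\<open>k > 0\<close>
  asks for Frechet differentiability and continuous directional derivatives, this is the usual
  class of k times continuously differentiable functions on an open set.\<close>

primrec Ck_on :: "nat \<Rightarrow> 'a::euclidean_space set \<Rightarrow> ('a \<Rightarrow> real) \<Rightarrow> bool" where
  "Ck_on 0 S f \<longleftrightarrow> continuous_on S f"
| "Ck_on (Suc k) S f \<longleftrightarrow>
     (\<forall>x\<in>S. f differentiable (at x)) \<and> (\<forall>v. Ck_on k S (\<lambda>x. frechet_derivative f (at x) v))"

definition smooth_on :: "'a::euclidean_space set \<Rightarrow> ('a \<Rightarrow> real) \<Rightarrow> bool" where
  "smooth_on S f \<longleftrightarrow> (\<forall>k. Ck_on k S f)"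

text \<open>Test functions on an open set \<^term>\<open>S\<close> are total functions on the ambient space; the support
  condition makes them the extension by zero of their restriction to \<^term>\<open>S\<close>.\<close>

definition test_functions :: "'a::euclidean_space set \<Rightarrow> ('a \<Rightarrow> real) set" where
  "test_functions S =
     {f. smooth_on S f \<and> compact (closure {x. f x \<noteq> 0}) \<and> closure {x. f x \<noteq> 0} \<subseteq> S}"

text \<open>Surface measure of the unit sphere, as the cone measure familiar from polar coordinates:
  the measure of \<^term>\<open>A\<close> is n times the volume of the cone \<open>{r x | 0 < r < 1, x \<in> A}\<close>
  (see \<open>emeasure_sphere_measure\<close> below). Here \<^term>\<open>sgn x\<close> is x divided by its norm.\<close>

definition sphere_measure :: "'a::euclidean_space measure" where
  "sphere_measure = scale_measure (of_nat DIM('a))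
     (distr (restrict_space lborel (ball 0 1 - {0})) (restrict_space borel (sphere 0 1)) sgn)"

definition sphere_area :: "'a::euclidean_space itself \<Rightarrow> real" where
  "sphere_area _ = measure (sphere_measure :: 'a measure) (sphere 0 1)"

definition spherical_mean :: "('a::euclidean_space \<Rightarrow> real) \<Rightarrow> 'a \<Rightarrow> real \<Rightarrow> real" where
  "spherical_mean f p t =
     1 / sphere_area TYPE('a) * (\<integral>\<theta>. f (p + t *\<^sub>R \<theta>) \<partial>sphere_measure)"

lemma measurable_sgn_sphere:
  "sgn \<in> measurable (restrict_space lborel (ball 0 1 - {0 :: 'a::euclidean_space}))
     (restrict_space borel (sphere 0 1))"
proof (rule measurable_restrict_space2)
  show "sgn \<in> space (restrict_space lborel (ball 0 1 - {0 :: 'a})) \<rightarrow> sphere 0 1"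
    by (auto simp: space_restrict_space norm_sgn)
  have "continuous_on (ball 0 1 - {0 :: 'a}) sgn"
    by (auto intro!: continuous_intros simp: sgn_div_norm)
  then have "sgn \<in> borel_measurable (restrict_space borel (ball 0 1 - {0 :: 'a}))"
    by (rule borel_measurable_continuous_on_restrict)
  then show "sgn \<in> borel_measurable (restrict_space lborel (ball 0 1 - {0 :: 'a}))"
    by (simp add: measurable_def space_restrict_space sets_restrict_space)
qed

lemma emeasure_sphere_measure:
  fixes A :: "'a::euclidean_space set"
  assumes A: "A \<in> sets borel" "A \<subseteq> sphere 0 1"
  shows "emeasure sphere_measure A =
    of_nat DIM('a) * emeasure lborel {r *\<^sub>R x | r x. 0 < r \<and> r < 1 \<and> x \<in> A}"
proof -
  let ?B = "ball 0 1 - {0 :: 'a}"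
  have "A \<in> sets (restrict_space borel (sphere 0 1))"
    using A by (auto simp: sets_restrict_space_iff)
  moreover have "sgn -` A \<inter> ?B = {r *\<^sub>R x | r x. 0 < r \<and> r < 1 \<and> x \<in> A}" (is "?L = ?R")
  proof
    show "?L \<subseteq> ?R"
    proof
      fix y assume y: "y \<in> ?L"
      then have "y = norm y *\<^sub>R sgn y" "0 < norm y" "norm y < 1" "sgn y \<in> A"
        by (auto simp: sgn_div_norm)
      then show "y \<in> ?R" by blast
    qed
    show "?R \<subseteq> ?L"
    proof
      fix y assume "y \<in> ?R"
      then obtain r x where "y = r *\<^sub>R x" "0 < r" "r < 1" "x \<in> A" by blast
      moreover have "norm x = 1" using A \<open>x \<in> A\<close> by auto
      ultimately show "y \<in> ?L" by (auto simp: sgn_div_norm)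
    qed
  qed
  moreover have "emeasure (restrict_space lborel ?B) (sgn -` A \<inter> ?B) = emeasure lborel (sgn -` A \<inter> ?B)"
    by (rule emeasure_restrict_space) auto
  ultimately show ?thesis
    by (simp add: sphere_measure_def emeasure_distr measurable_sgn_sphere space_restrict_space)
qed

lemma sphere_area_eq: "sphere_area TYPE('a::euclidean_space) = DIM('a) * unit_ball_vol DIM('a)"
proof -
  have *: "{r *\<^sub>R x | r x. 0 < r \<and> r < 1 \<and> x \<in> sphere (0::'a) 1} = ball 0 1 - {0}"
  proof
    show "{r *\<^sub>R x | r x. 0 < r \<and> r < 1 \<and> x \<in> sphere (0::'a) 1} \<subseteq> ball 0 1 - {0}"
      by auto
    show "ball 0 1 - {0} \<subseteq> {r *\<^sub>R x | r x. 0 < r \<and> r < 1 \<and> x \<in> sphere (0::'a) 1}"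
    proof
      fix y :: 'a assume "y \<in> ball 0 1 - {0}"
      then have "y = norm y *\<^sub>R sgn y" "0 < norm y" "norm y < 1" "sgn y \<in> sphere 0 1"
        by (auto simp: sgn_div_norm)
      then show "y \<in> {r *\<^sub>R x | r x. 0 < r \<and> r < 1 \<and> x \<in> sphere (0::'a) 1}" by blast
    qed
  qed
  have "emeasure lborel (ball 0 1 - {0::'a}) = ennreal (unit_ball_vol DIM('a))"
    by (subst emeasure_Diff) (auto simp: emeasure_ball)
  then have "emeasure (sphere_measure :: 'a measure) (sphere 0 1)
      = ennreal (DIM('a) * unit_ball_vol DIM('a))"
    using *
    by (subst emeasure_sphere_measure)
       (simp_all add: ennreal_mult unit_ball_vol_nonneg flip: ennreal_of_nat_eq_real_of_nat)
  then show ?thesis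
    by (simp add: sphere_area_def measure_def unit_ball_vol_nonneg)
qed

end

theory Submission
  imports Defs
begin

text \<open>
  The function is radial, \<open>f x = G (norm(x)^2)\<close>. For p on the unit sphere,
  \<open>norm(p + t x)^2 = 1 + t^2 + 2 t (p \<bullet> x)\<close> for unit vectors x, so the spherical mean of f is
  the integral over the sphere of a function of \<open>s = p \<bullet> x\<close> alone. In dimension
  n = 2 k + 3, the distribution of s has a density proportional to \<open>(1 - s^2)^k\<close>, which is a
  polynomial of degree 2 k because n is odd. If U lies in the closed ball of radius r < 1 and G
  is supported in the open interval from \<open>r^2\<close> to 1, then f vanishes on U. Moreover, a sphere
  centred on the unit sphere that meets U has a radius t with \<open>\<bar>1 - t\<bar> \<le> r\<close>, so
  that the values of \<open>1 + t^2 + 2 t s\<close> cover the whole support of G, and the mean is the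
  integral of G against a polynomial of degree at most 2 k. All these integrals vanish if G is the
  derivative of order 2 k + 1 of a bump function
  (\<open>ex_antiderivative_poly_times_higher_deriv\<close>).

  The density of s is replaced by rotation invariance. Differentiating the integral of a rotated
  function over the sphere yields
  \<open>\<integral> (1 - s^2) a'(s) - (n - 1) s a(s) = 0\<close> for every continuously differentiable a
  (\<open>integral_sphere_zonal_divergence\<close>). An integrand h(s) has this form with
  \<open>a = P / (1 - s^2)^(k+1)\<close>, where \<open>P' = h (1 - s^2)^k\<close>, and a is continuously
  differentiable if P vanishes near -1 and 1 (\<open>integral_sphere_zonal_eq_0\<close>).
\<close>

section \<open>Smooth functions\<close>

lemma Ck_on_SucI:
  assumes "\<And>x. (f has_derivative f' x) (at x)" and "\<And>v. Ck_on k UNIV (\<lambda>x. f' x v)"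
  shows "Ck_on (Suc k) UNIV f"
proof -
  have "frechet_derivative f (at x) = f' x" for x
    using frechet_derivative_at[OF assms(1)] by simp
  then show ?thesis
    using assms by (auto simp: differentiable_def)
qed

lemma Ck_on_SucD: "Ck_on (Suc k) S f \<Longrightarrow> Ck_on k S f"
proof (induction k arbitrary: f)
  case 0
  then show ?case
    by (auto intro!: continuous_at_imp_continuous_on differentiable_imp_continuous_within)
next
  case (Suc k)
  then show ?case by (metis Ck_on.simps(2))
qed

lemma Ck_on_mono:
  assumes "Ck_on k T f" "S \<subseteq> T"
  shows "Ck_on k S f"
  using assms by (induction k arbitrary: f) (auto intro: continuous_on_subset)

lemma Ck_on_has_derivative:
  assumes "Ck_on (Suc k) UNIV f"
  shows "(f has_derivative frechet_derivative f (at x)) (at x)"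
  using assms by (auto simp: frechet_derivative_works)

lemma Ck_on_const: "Ck_on k UNIV (\<lambda>x. c)"
  by (induction k arbitrary: c) (auto simp del: Ck_on.simps(2) intro!: Ck_on_SucI[where f' = "\<lambda>_ _. 0"])

lemma Ck_on_add:
  assumes "Ck_on k UNIV f" "Ck_on k UNIV g"
  shows "Ck_on k UNIV (\<lambda>x. f x + g x)"
  using assms
proof (induction k arbitrary: f g)
  case 0
  then show ?case by (auto intro: continuous_intros)
next
  case (Suc k)
  show ?case
    by (rule Ck_on_SucI[OF has_derivative_add[OF Ck_on_has_derivative Ck_on_has_derivative]])
      (use Suc in auto)
qed

text \<open>The derivative f g' + f' g contains undifferentiated factors, whose order has to be lowered before
  the induction hypothesis applies.\<close>

lemma Ck_on_mult:
  assumes "Ck_on k UNIV f" "Ck_on k UNIV g"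
  shows "Ck_on k UNIV (\<lambda>x. f x * g x)"
  using assms
proof (induction k arbitrary: f g)
  case 0
  then show ?case by (auto intro: continuous_intros)
next
  case (Suc k)
  have "Ck_on k UNIV f" "Ck_on k UNIV g"
    using Suc.prems by (auto intro: Ck_on_SucD)
  then have "Ck_on k UNIV (\<lambda>x. f x * frechet_derivative g (at x) v + frechet_derivative f (at x) v * g x)" for v
    using Suc.prems by (intro Ck_on_add Suc.IH) auto
  then show ?case
    by (rule Ck_on_SucI[OF has_derivative_mult[OF Suc.prems[THEN Ck_on_has_derivative]]])
qed

lemma Ck_on_linear:
  fixes f :: "'a::euclidean_space \<Rightarrow> real"
  assumes "linear f"
  shows "Ck_on k UNIV f"
proof (cases k)
  case 0
  then show ?thesis using assms by (simp add: linear_continuous_on linear_linear)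
next
  case (Suc m)
  then show ?thesis
    using assms linear_imp_has_derivative[OF assms]
    by (auto simp del: Ck_on.simps(2) intro!: Ck_on_SucI[where f' = "\<lambda>_. f"] Ck_on_const)
qed

lemma smooth_on_deriv:
  fixes g :: "real \<Rightarrow> real"
  assumes "smooth_on UNIV g"
  shows "(g has_real_derivative deriv g x) (at x)" "smooth_on UNIV (deriv g)"
proof -
  have Ck: "Ck_on (Suc k) UNIV g" for k
    using assms unfolding smooth_on_def by blast
  have "g differentiable at x" for x
    using Ck[of 0] by simp
  then have D: "(g has_real_derivative deriv g x) (at x)" for x
    by (metis DERIV_deriv_iff_real_differentiable)
  then show "(g has_real_derivative deriv g x) (at x)" .
  have "frechet_derivative g (at x) 1 = deriv g x" for x
    using frechet_derivative_at[OF D[unfolded has_field_derivative_def]] by (metis mult.right_neutral)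
  then show "smooth_on UNIV (deriv g)"
    unfolding smooth_on_def using Ck by (metis (no_types, lifting) Ck_on.simps(2) ext)
qed

lemma smooth_on_higher_deriv:
  fixes g :: "real \<Rightarrow> real"
  assumes "smooth_on UNIV g"
  shows "smooth_on UNIV ((deriv ^^ m) g)"
  using assms by (induction m) (auto intro: smooth_on_deriv)

lemma smooth_on_continuous:
  assumes "smooth_on S f" shows "continuous_on S f"
  using assms unfolding smooth_on_def by (metis Ck_on.simps(1))

text \<open>The outer function varies in the induction on the order, because the chain rule replaces it by
  its derivative.\<close>

lemma smooth_on_compose:
  fixes g :: "real \<Rightarrow> real" and u :: "'a::euclidean_space \<Rightarrow> real"
  assumes "smooth_on UNIV g" "smooth_on UNIV u"
  shows "smooth_on UNIV (\<lambda>x. g (u x))"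
proof -
  have u: "Ck_on k UNIV u" for k
    using assms(2) by (simp add: smooth_on_def)
  have "Ck_on k UNIV (\<lambda>x. g (u x))" for k
    using assms(1)
  proof (induction k arbitrary: g)
    case 0
    then show ?case
      using smooth_on_continuous[OF 0] u[of 0]
      by (auto intro: continuous_on_compose2)
  next
    case (Suc k)
    have "Ck_on k UNIV (\<lambda>x. frechet_derivative u (at x) v * deriv g (u x))" for v
      using u[of "Suc k"] by (intro Ck_on_mult Suc.IH smooth_on_deriv Suc.prems) auto
    moreover have "((\<lambda>x. g (u x)) has_derivative (\<lambda>v. frechet_derivative u (at x) v * deriv g (u x))) (at x)" for x
      using DERIV_compose_FDERIV[OF smooth_on_deriv(1)[OF Suc.prems] Ck_on_has_derivative[OF u]] .
    ultimately show ?case by (intro Ck_on_SucI)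
  qed
  then show ?thesis by (simp add: smooth_on_def)
qed

section \<open>Bump functions and vanishing moments\<close>

text \<open>The classical flat function exp(-1/x), here with a factor that is a polynomial in 1/x: with
  this factor the family is closed under differentiation.\<close>

definition flat :: "real poly \<Rightarrow> real \<Rightarrow> real" where
  "flat p x = (if x > 0 then poly p (1 / x) * exp (- (1 / x)) else 0)"

lemma tendsto_poly_exp_0: "((\<lambda>u. poly p u * exp (- u)) \<longlongrightarrow> (0::real)) at_top"
proof -
  have "((\<lambda>u. \<Sum>i\<le>degree p. coeff p i * (u ^ i / exp u)) \<longlongrightarrow> (\<Sum>i\<le>degree p. coeff p i * (0::real))) at_top"
    by (intro tendsto_intros tendsto_power_div_exp_0)
  then show ?thesis
    by (simp add: poly_altdef exp_minus sum_distrib_right divide_inverse mult.assoc)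
qed

lemma flat_tendsto_0: "(flat p \<longlongrightarrow> 0) (at 0)"
proof -
  have "((\<lambda>x. poly p (inverse x) * exp (- inverse x)) \<longlongrightarrow> 0) (at_right 0)"
    by (rule filterlim_compose[OF tendsto_poly_exp_0 filterlim_inverse_at_top_right])
  then have "(flat p \<longlongrightarrow> 0) (at_right 0)"
    by (rule Lim_transform_eventually)
      (auto simp: eventually_at_filter flat_def divide_inverse)
  moreover have "(flat p \<longlongrightarrow> 0) (at_left 0)"
    by (rule Lim_transform_eventually[OF tendsto_const])
      (auto simp: eventually_at_filter flat_def)
  ultimately show ?thesis by (simp add: filterlim_at_split)
qed

text \<open>With u = 1/x one has u' = -u^2, which turns the polynomial p into u^2 (p - p'). At 0, the
  difference quotient is again a flat function, whose polynomial is u p, and thus tends to 0.\<close>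

lemma flat_has_derivative:
  "(flat p has_real_derivative flat ([:0, 0, 1:] * (p - pderiv p)) x) (at x)"
proof -
  consider "x > 0" | "x < 0" | "x = 0" by linarith
  then show ?thesis
  proof cases
    case 1
    have "((\<lambda>x. poly p (1 / x) * exp (- (1 / x))) has_real_derivative
        flat ([:0, 0, 1:] * (p - pderiv p)) x) (at x)"
      using 1 by (auto intro!: derivative_eq_intros DERIV_chain2[OF poly_DERIV]
          simp: flat_def field_simps power2_eq_square)
    then show ?thesis
      by (rule has_field_derivative_transform_within_open[of _ _ _ "{0<..}"])
        (use 1 in \<open>auto simp: flat_def\<close>)
  next
    case 2
    have "((\<lambda>x. 0) has_real_derivative flat ([:0, 0, 1:] * (p - pderiv p)) x) (at x)"
      using 2 by (simp add: flat_def)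
    then show ?thesis
      by (rule has_field_derivative_transform_within_open[of _ _ _ "{..<0}"])
        (use 2 in \<open>auto simp: flat_def\<close>)
  next
    case 3
    have "(flat p (0 + h) - flat p 0) / h = flat (pCons 0 p) h" for h
      by (simp add: flat_def)
    then have "(flat p has_real_derivative 0) (at 0)"
      using flat_tendsto_0[of "pCons 0 p"] by (simp add: DERIV_def)
    then show ?thesis
      using 3 by (simp add: flat_def)
  qed
qed

lemma smooth_on_flat: "smooth_on UNIV (flat p)"
proof -
  have "Ck_on k UNIV (flat p)" for k
  proof (induction k arbitrary: p)
    case 0
    show ?case
      using flat_has_derivative[of p] DERIV_isCont by (auto simp: continuous_on_eq_continuous_at)
  next
    case (Suc k)
    show ?case
      by (rule Ck_on_SucI[OF flat_has_derivative[unfolded has_field_derivative_def]])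
        (intro Ck_on_mult Ck_on_const Suc.IH)
  qed
  then show ?thesis by (simp add: smooth_on_def)
qed

lemma ex_smooth_bump:
  fixes a b :: real
  assumes "a < b"
  shows "\<exists>g. smooth_on UNIV g \<and> (\<forall>v. v \<notin> {a..b} \<longrightarrow> g v = 0) \<and> g \<noteq> (\<lambda>v. 0)"
proof (intro exI conjI)
  let ?g = "\<lambda>v. flat 1 (v + - a) * flat 1 (b + - 1 * v)"
  have "smooth_on UNIV (\<lambda>v::real. v + - a)" "smooth_on UNIV (\<lambda>v::real. b + - 1 * v)"
    unfolding smooth_on_def by (intro allI Ck_on_add Ck_on_mult Ck_on_const Ck_on_linear linear_ident)+
  from this[THEN smooth_on_compose[OF smooth_on_flat]] show "smooth_on UNIV ?g"
    unfolding smooth_on_def by (intro allI Ck_on_mult) (blast+)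
  show "\<forall>v. v \<notin> {a..b} \<longrightarrow> ?g v = 0"
    by (auto simp: flat_def)
  have "?g ((a + b) / 2) \<noteq> 0"
    using assms by (simp add: flat_def field_simps)
  then show "?g \<noteq> (\<lambda>v. 0)" by metis
qed

lemma higher_deriv_eq_0_outside:
  fixes g :: "real \<Rightarrow> real"
  assumes "\<forall>v. v \<notin> {a..b} \<longrightarrow> g v = 0" "v \<notin> {a..b}"
  shows "(deriv ^^ m) g v = 0"
  using assms(2)
proof (induction m arbitrary: v)
  case 0
  then show ?case using assms(1) by simp
next
  case (Suc m)
  have "((deriv ^^ m) g has_real_derivative 0) (at v)"
    by (rule has_field_derivative_transform_within_open[of "\<lambda>_. 0" _ _ "- {a..b}"])
      (use Suc in auto)
  then show ?case by (simp add: DERIV_imp_deriv)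
qed

text \<open>A function that vanishes far out and has derivative 0 everywhere is 0, so differentiation
  never kills a nonzero function that vanishes outside a bounded interval.\<close>

lemma higher_deriv_nonzero:
  fixes g :: "real \<Rightarrow> real"
  assumes g: "smooth_on UNIV g" "\<forall>v. v \<notin> {a..b} \<longrightarrow> g v = 0" "g \<noteq> (\<lambda>v. 0)"
  shows "(deriv ^^ m) g \<noteq> (\<lambda>v. 0)"
proof (induction m)
  case 0
  then show ?case using g by simp
next
  case (Suc m)
  show ?case
  proof
    assume "(deriv ^^ Suc m) g = (\<lambda>v. 0)"
    then have "((deriv ^^ m) g has_real_derivative 0) (at v)" for v
      using smooth_on_deriv(1)[OF smooth_on_higher_deriv[OF g(1), of m], of v] by simp
    then have "(deriv ^^ m) g v = (deriv ^^ m) g (b + 1)" for v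
      by (intro DERIV_isconst_all) blast
    moreover have "(deriv ^^ m) g (b + 1) = 0"
      using g(2) by (intro higher_deriv_eq_0_outside) auto
    ultimately show False using Suc by auto
  qed
qed

lemma higher_pderiv_eq_0:
  fixes q :: "real poly"
  assumes "degree q < m"
  shows "(pderiv ^^ m) q = 0"
  using assms
proof (induction m arbitrary: q)
  case (Suc m)
  show ?case
  proof (cases "degree q = 0")
    case True
    then have "pderiv q = 0" by (simp add: pderiv_eq_0_iff)
    moreover have "(pderiv ^^ m) (0 :: real poly) = 0" by (induction m) auto
    ultimately show ?thesis by (simp add: funpow_swap1)
  next
    case False
    then have "(pderiv ^^ m) (pderiv q) = 0"
      using Suc by (intro Suc.IH) (simp add: degree_pderiv)
    then show ?thesis by (simp add: funpow_swap1)
  qed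
qed simp

text \<open>Repeated integration by parts: q g^(m+1) = (q g^(m))' - q' g^(m), and after m steps no
  derivative of q is left. That the antiderivative vanishes on both sides of the support of g says
  that the m-th derivative of g is orthogonal to every polynomial of degree less than m.\<close>

lemma ex_antiderivative_poly_times_higher_deriv:
  fixes g :: "real \<Rightarrow> real"
  assumes g: "smooth_on UNIV g" "\<forall>v. v \<notin> {a..b} \<longrightarrow> g v = 0"
    and "(pderiv ^^ m) q = 0"
  shows "\<exists>P. (\<forall>v. (P has_real_derivative poly q v * (deriv ^^ m) g v) (at v)) \<and>
    (\<forall>v. v \<notin> {a..b} \<longrightarrow> P v = 0)"
  using assms(3)
proof (induction m arbitrary: q)
  case 0
  then show ?case by (intro exI[of _ "\<lambda>_. 0"]) simp
next
  case (Suc m)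
  then have "(pderiv ^^ m) (pderiv q) = 0" by (simp add: funpow_swap1)
  from Suc.IH[OF this] obtain P where
    P: "\<And>v. (P has_real_derivative poly (pderiv q) v * (deriv ^^ m) g v) (at v)"
      "\<And>v. v \<notin> {a..b} \<Longrightarrow> P v = 0" by blast
  have g': "((deriv ^^ m) g has_real_derivative (deriv ^^ Suc m) g v) (at v)" for v
    using smooth_on_deriv(1)[OF smooth_on_higher_deriv[OF g(1), of m], of v] by simp
  show ?case
  proof (intro exI[of _ "\<lambda>v. poly q v * (deriv ^^ m) g v - P v"] conjI allI impI)
    show "((\<lambda>v. poly q v * (deriv ^^ m) g v - P v) has_real_derivative
        poly q v * (deriv ^^ Suc m) g v) (at v)" for v
      using DERIV_diff[OF DERIV_mult[OF poly_DERIV g'] P(1), of q v]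
      by (simp add: algebra_simps)
    show "poly q v * (deriv ^^ m) g v - P v = 0" if "v \<notin> {a..b}" for v
      using that P(2) higher_deriv_eq_0_outside[OF g(2) that] by simp
  qed
qed

section \<open>Radial test functions\<close>

lemma smooth_on_radial:
  assumes "smooth_on UNIV g"
  shows "smooth_on UNIV (\<lambda>x::'a::euclidean_space. g ((norm x)\<^sup>2))"
proof -
  have "Ck_on k UNIV (\<lambda>x::'a. \<Sum>b\<in>B. (x \<bullet> b) * (x \<bullet> b))" for B k
  proof (induction B rule: infinite_finite_induct)
    case (insert b B)
    have "linear (\<lambda>x. x \<bullet> b)"
      by (rule linearI) (simp_all add: inner_add_left)
    with insert show ?case
      by (simp add: Ck_on_add Ck_on_mult Ck_on_linear)
  qed (simp_all add: Ck_on_const)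
  moreover have "(\<Sum>b\<in>Basis. (x \<bullet> b) * (x \<bullet> b)) = (norm x)\<^sup>2" for x :: 'a
    by (simp add: euclidean_inner[symmetric] power2_norm_eq_inner)
  ultimately have "Ck_on k UNIV (\<lambda>x::'a. (norm x)\<^sup>2)" for k
    by (metis (no_types, lifting) ext)
  then show ?thesis
    by (intro smooth_on_compose[OF assms]) (simp add: smooth_on_def)
qed

lemma radial_test_function:
  fixes a b :: real
  assumes g: "smooth_on UNIV g" "\<forall>v. v \<notin> {a..b} \<longrightarrow> g v = 0" and "b < 1"
  shows "(\<lambda>x. g ((norm x)\<^sup>2)) \<in> test_functions (ball (0::'a::euclidean_space) 1)"
proof -
  let ?f = "\<lambda>x::'a. g ((norm x)\<^sup>2)"
  have "{x. ?f x \<noteq> 0} \<subseteq> cball 0 (sqrt b)"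
    using g(2) by (auto intro!: real_le_rsqrt)
  then have supp: "closure {x. ?f x \<noteq> 0} \<subseteq> cball 0 (sqrt b)"
    by (rule closure_minimal) simp
  also have "\<dots> \<subseteq> ball 0 1"
    using real_sqrt_less_mono[OF \<open>b < 1\<close>] unfolding real_sqrt_one subset_iff mem_cball_0 mem_ball_0
    by (blast intro: order.strict_trans1)
  finally have "closure {x. ?f x \<noteq> 0} \<subseteq> ball 0 1" .
  moreover have "compact (closure {x. ?f x \<noteq> 0})"
    using supp by (meson bounded_cball bounded_subset closed_closure compact_eq_bounded_closed)
  moreover have "smooth_on (ball 0 1) ?f"
    using smooth_on_radial[OF g(1)] Ck_on_mono unfolding smooth_on_def by blast
  ultimately show ?thesis by (simp add: test_functions_def)
qed

section \<open>Rotation invariance of the surface measure\<close>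

lemma distr_lborel_translation:
  "distr lborel borel (\<lambda>x. c + x) = (lborel :: 'a::euclidean_space measure)"
  using lborel_affine[of 1 c] by (simp add: density_1)

text \<open>Uniqueness of Haar measure. The image measure M is translation invariant, so for every Borel set
  A and the unit ball B, shifting x by y, then y by -x, then x by y shows that
  \<open>M A * vol B = vol A * M B\<close> by Fubini. The symmetry of B is what makes the last shift
  come out as B again, and M B = vol B because the map preserves norms.\<close>

lemma lborel_distr_orthogonal_transformation:
  fixes R :: "'a::euclidean_space \<Rightarrow> 'a"
  assumes "orthogonal_transformation R"
  shows "distr lborel borel R = lborel"
proof -
  have lin: "linear R" and surj: "surj R"
    using assms by (simp_all add: orthogonal_transformation_linear orthogonal_transformation_surj)
  have nrm: "norm (R x) = norm x" for x
    using assms by (rule orthogonal_transformation_norm)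
  have [measurable]: "R \<in> borel_measurable borel"
    using lin by (simp add: borel_measurable_continuous_onI linear_continuous_on linear_linear)
  define M where "M = distr lborel borel R"
  have [measurable_cong]: "sets M = sets borel" by (simp add: M_def)
  have R_ball: "R -` ball 0 r = ball 0 r" for r
    by (auto simp: nrm)
  have emeasure_ball: "emeasure M (ball 0 r) = emeasure lborel (ball (0::'a) r)" for r
    by (simp add: M_def emeasure_distr R_ball)
  have "sigma_finite_measure M"
  proof (rule sigma_finite_measure.intro, intro exI[of _ "range (\<lambda>n. ball 0 (real n))"] conjI)
    show "\<Union> (range (\<lambda>n. ball 0 (real n))) = space M"
      by (auto simp: M_def reals_Archimedean2)
    show "\<forall>A\<in>range (\<lambda>n. ball 0 (real n)). emeasure M A \<noteq> \<infinity>"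
      using emeasure_lborel_ball_finite[of "0::'a"] by (auto simp: emeasure_ball less_top)
  qed (auto simp: M_def)
  then interpret pair_sigma_finite M "lborel :: 'a measure"
    by (simp add: pair_sigma_finite_def lborel.sigma_finite_measure_axioms)
  have transl: "(\<integral>\<^sup>+x. f (c + x) \<partial>M) = (\<integral>\<^sup>+x. f x \<partial>M)" if [measurable]: "f \<in> borel_measurable borel" for f c
  proof -
    obtain d where d: "R d = c" using surj by (metis surjD)
    have "(\<integral>\<^sup>+x. f (c + x) \<partial>M) = (\<integral>\<^sup>+x. f (R (d + x)) \<partial>lborel)"
      by (simp add: M_def nn_integral_distr d linear_add[OF lin])
    also have "\<dots> = (\<integral>\<^sup>+x. f (R x) \<partial>distr lborel borel (\<lambda>x. d + x))"
      by (subst nn_integral_distr) auto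
    also have "\<dots> = (\<integral>\<^sup>+x. f x \<partial>M)"
      by (simp add: M_def nn_integral_distr distr_lborel_translation)
    finally show ?thesis .
  qed
  have transl': "(\<integral>\<^sup>+x. f (c + x) \<partial>lborel) = (\<integral>\<^sup>+x. f x \<partial>lborel)" if [measurable]: "f \<in> borel_measurable borel" for f and c :: 'a
    by (subst (2) distr_lborel_translation[of c, symmetric]) (simp add: nn_integral_distr)
  let ?B = "ball 0 1 :: 'a set"
  have [measurable]: "?B \<in> sets borel" by simp
  have "M = lborel"
  proof (rule measure_eqI)
    fix A assume "A \<in> sets M"
    then have [measurable]: "A \<in> sets borel" by (simp add: M_def)
    have "emeasure M A * emeasure lborel ?B = (\<integral>\<^sup>+y. \<integral>\<^sup>+x. indicator A x * indicator ?B y \<partial>M \<partial>lborel)"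
      by (simp add: nn_integral_cmult nn_integral_multc nn_integral_cmult_indicator)
    also have "\<dots> = (\<integral>\<^sup>+y. \<integral>\<^sup>+x. indicator A (y + x) * indicator ?B y \<partial>M \<partial>lborel)"
      by (intro nn_integral_cong transl[where f = "\<lambda>x. indicator A x * indicator ?B y" for y, symmetric]) simp
    also have "\<dots> = (\<integral>\<^sup>+x. \<integral>\<^sup>+y. indicator A (y + x) * indicator ?B y \<partial>lborel \<partial>M)"
      by (rule Fubini') measurable
    also have "\<dots> = (\<integral>\<^sup>+x. \<integral>\<^sup>+y. indicator A (x + y) * indicator ?B (x + y - x) \<partial>lborel \<partial>M)"
      by (simp add: add.commute)
    also have "\<dots> = (\<integral>\<^sup>+x. \<integral>\<^sup>+y. indicator A y * indicator ?B (y - x) \<partial>lborel \<partial>M)"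
      by (intro nn_integral_cong transl'[where f = "\<lambda>y. indicator A y * indicator ?B (y - x)" for x]) simp
    also have "\<dots> = (\<integral>\<^sup>+y. \<integral>\<^sup>+x. indicator A y * indicator ?B (y - x) \<partial>M \<partial>lborel)"
      by (rule Fubini'[symmetric]) measurable
    also have "\<dots> = (\<integral>\<^sup>+y. \<integral>\<^sup>+x. indicator A y * indicator ?B (y - (y + x)) \<partial>M \<partial>lborel)"
      by (intro nn_integral_cong transl[where f = "\<lambda>x. indicator A y * indicator ?B (y - x)" for y, symmetric]) simp
    also have "\<dots> = (\<integral>\<^sup>+y. \<integral>\<^sup>+x. indicator A y * indicator ?B x \<partial>M \<partial>lborel)"
      by (simp add: indicator_def)
    also have "\<dots> = emeasure lborel A * emeasure M ?B"
      by (simp add: nn_integral_cmult nn_integral_multc nn_integral_cmult_indicator)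
    finally have "emeasure lborel ?B * emeasure M A = emeasure lborel ?B * emeasure lborel A"
      by (simp add: emeasure_ball mult.commute)
    moreover have "emeasure lborel ?B \<noteq> 0" "emeasure lborel ?B \<noteq> \<infinity>"
      using emeasure_lborel_ball_finite[of "0::'a" 1] by (auto simp: Ball_Volume.emeasure_ball less_imp_neq[symmetric])
    ultimately show "emeasure M A = emeasure lborel A"
      by (simp add: ennreal_mult_cancel_left)
  qed (simp add: M_def)
  then show ?thesis by (simp add: M_def)
qed

lemma scale_measure_eq_density: "scale_measure c M = density M (\<lambda>_. c)"
  by (rule measure_eqI) (auto simp: emeasure_density_const)

lemma integral_sphere_measure:
  fixes h :: "'a::euclidean_space \<Rightarrow> real"
  assumes [measurable]: "h \<in> borel_measurable borel"
  shows "(\<integral>x. h x \<partial>sphere_measure) = DIM('a) * (\<integral>x. indicator (ball 0 1 - {0}) x * h (sgn x) \<partial>lborel)"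
proof -
  have [measurable]: "h \<in> borel_measurable (restrict_space borel (sphere 0 1))"
    by (rule measurable_restrict_space1) simp
  note measurable_sgn_sphere[measurable]
  have "(\<integral>x. h x \<partial>sphere_measure) =
      (\<integral>x. real DIM('a) * h x \<partial>distr (restrict_space lborel (ball 0 1 - {0})) (restrict_space borel (sphere 0 1)) sgn)"
    unfolding sphere_measure_def scale_measure_eq_density ennreal_of_nat_eq_real_of_nat
    by (subst integral_density) auto
  also have "\<dots> = (\<integral>x. real DIM('a) * h (sgn x) \<partial>restrict_space lborel (ball 0 1 - {0}))"
    by (subst integral_distr) auto
  also have "\<dots> = DIM('a) * (\<integral>x. indicator (ball 0 1 - {0}) x * h (sgn x) \<partial>lborel)"
    by (subst integral_restrict_space) (auto simp: mult.left_commute)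
  finally show ?thesis .
qed

lemma space_sphere_measure: "space sphere_measure = sphere 0 1"
  by (simp add: sphere_measure_def space_scale_measure space_restrict_space)

lemma finite_sphere_measure: "finite_measure (sphere_measure :: 'a::euclidean_space measure)"
proof
  have "emeasure lborel (ball 0 1 - {0::'a}) < \<infinity>"
    using emeasure_lborel_ball_finite[of "0::'a" 1]
    by (metis Diff_subset emeasure_mono infinity_ennreal_def open_ball borel_open order.strict_trans1 sets_lborel)
  moreover have "sgn -` sphere 0 1 \<inter> (ball 0 1 - {0}) = ball 0 1 - {0::'a}"
    by (auto simp: norm_sgn)
  ultimately show "emeasure sphere_measure (space (sphere_measure :: 'a measure)) \<noteq> \<infinity>"
    unfolding space_sphere_measure
    unfolding sphere_measure_def emeasure_scale_measure
    by (subst emeasure_distr[OF measurable_sgn_sphere])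
      (auto simp: sets_restrict_space_iff emeasure_restrict_space ennreal_mult_eq_top_iff
        space_restrict_space)
qed

lemma borel_measurable_sphere_measure:
  fixes h :: "'a::euclidean_space \<Rightarrow> real"
  assumes "h \<in> borel_measurable borel"
  shows "h \<in> borel_measurable sphere_measure"
proof -
  have "sets sphere_measure = sets (restrict_space borel (sphere (0::'a) 1))"
    by (simp add: sphere_measure_def)
  from measurable_cong_sets[OF this refl] show ?thesis
    using measurable_restrict_space1[OF assms] by blast
qed

lemma integral_sphere_measure_orthogonal:
  fixes h :: "'a::euclidean_space \<Rightarrow> real" and R :: "'a \<Rightarrow> 'a"
  assumes [measurable]: "h \<in> borel_measurable borel" and R: "orthogonal_transformation R"
  shows "(\<integral>x. h (R x) \<partial>sphere_measure) = (\<integral>x. h x \<partial>sphere_measure)"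
proof -
  have lin: "linear R" using R orthogonal_transformation_linear by blast
  have [measurable]: "R \<in> borel_measurable borel"
    using lin by (simp add: borel_measurable_continuous_onI linear_continuous_on linear_linear)
  have nrm: "norm (R x) = norm x" for x using R orthogonal_transformation_norm by blast
  have sgn_R: "R (sgn x) = sgn (R x)" for x
    by (simp add: sgn_div_norm nrm linear_scale[OF lin])
  have ball: "R x \<in> ball 0 1 - {0} \<longleftrightarrow> x \<in> ball 0 1 - {0}" for x
    using nrm[of x] norm_eq_zero[of x] norm_eq_zero[of "R x"] by auto
  have [measurable]: "(\<lambda>x. indicator (ball 0 1 - {0}) x * h (sgn x)) \<in> borel_measurable borel"
    by (intro borel_measurable_times borel_measurable_indicator measurable_compose[of sgn _ borel h]) auto
  have "(\<integral>x. indicator (ball 0 1 - {0}) x * h (R (sgn x)) \<partial>lborel) =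
      (\<integral>x. indicator (ball 0 1 - {0}) (R x) * h (sgn (R x)) \<partial>lborel)"
    using ball by (simp add: indicator_def sgn_R)
  also have "\<dots> = (\<integral>x. indicator (ball 0 1 - {0}) x * h (sgn x) \<partial>distr lborel borel R)"
    by (subst integral_distr) auto
  also have "\<dots> = (\<integral>x. indicator (ball 0 1 - {0}) x * h (sgn x) \<partial>lborel)"
    unfolding lborel_distr_orthogonal_transformation[OF R] ..
  finally have eq: "(\<integral>x. indicator (ball 0 1 - {0}) x * h (R (sgn x)) \<partial>lborel) =
      (\<integral>x. indicator (ball 0 1 - {0}) x * h (sgn x) \<partial>lborel)" .
  have "(\<lambda>x. h (R x)) \<in> borel_measurable borel" by measurable
  from integral_sphere_measure[OF this] integral_sphere_measure[OF assms(1)] show ?thesis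
    unfolding eq by (rule trans[OF _ sym])
qed

section \<open>Zonal integrals over the sphere\<close>

lemma integrable_sphere_measure:
  fixes h :: "'a::euclidean_space \<Rightarrow> real"
  assumes "continuous_on UNIV h"
  shows "integrable sphere_measure h"
proof -
  have "compact (h ` sphere 0 1)"
    using assms by (intro compact_continuous_image continuous_on_subset[OF assms]) auto
  then obtain C where "\<And>x. x \<in> sphere 0 1 \<Longrightarrow> norm (h x) \<le> C"
    using compact_imp_bounded bounded_iff by (metis imageI)
  then show ?thesis
    using assms
    by (intro finite_measure.integrable_const_bound[OF finite_sphere_measure, of _ C]
        borel_measurable_sphere_measure borel_measurable_continuous_onI)
      (auto simp: space_sphere_measure intro!: AE_I2)
qed

text \<open>For orthonormal p and q: the rotation by the angle \<open>\<tau>\<close> in their plane,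
  which fixes the orthogonal complement.\<close>

definition plane_rotation :: "'a::euclidean_space \<Rightarrow> 'a \<Rightarrow> real \<Rightarrow> 'a \<Rightarrow> 'a" where
  "plane_rotation p q \<tau> x = x + (cos \<tau> - 1) *\<^sub>R ((p \<bullet> x) *\<^sub>R p + (q \<bullet> x) *\<^sub>R q)
     + sin \<tau> *\<^sub>R ((p \<bullet> x) *\<^sub>R q - (q \<bullet> x) *\<^sub>R p)"

lemma inner_plane_rotation:
  assumes "norm p = 1" "norm q = 1" "p \<bullet> q = 0"
  shows "p \<bullet> plane_rotation p q \<tau> x = cos \<tau> * (p \<bullet> x) - sin \<tau> * (q \<bullet> x)"
    and "q \<bullet> plane_rotation p q \<tau> x = cos \<tau> * (q \<bullet> x) + sin \<tau> * (p \<bullet> x)"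
  using assms
  by (simp_all add: plane_rotation_def inner_add_right inner_diff_right inner_commute[of q p]
      norm_eq_1 algebra_simps)

lemma orthogonal_plane_rotation:
  assumes "norm p = 1" "norm q = 1" "p \<bullet> q = 0"
  shows "orthogonal_transformation (plane_rotation p q \<tau>)"
  unfolding orthogonal_transformation
proof
  show "linear (plane_rotation p q \<tau>)"
    by (rule linearI) (simp_all add: plane_rotation_def inner_add_right algebra_simps)
  have "plane_rotation p q \<tau> x \<bullet> plane_rotation p q \<tau> x = x \<bullet> x" for x
  proof -
    have expand: "(x + c *\<^sub>R ((p \<bullet> x) *\<^sub>R p + (q \<bullet> x) *\<^sub>R q) + d *\<^sub>R ((p \<bullet> x) *\<^sub>R q - (q \<bullet> x) *\<^sub>R p)) \<bullet>
        (x + c *\<^sub>R ((p \<bullet> x) *\<^sub>R p + (q \<bullet> x) *\<^sub>R q) + d *\<^sub>R ((p \<bullet> x) *\<^sub>R q - (q \<bullet> x) *\<^sub>R p)) =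
        x \<bullet> x + ((p \<bullet> x)\<^sup>2 + (q \<bullet> x)\<^sup>2) * (c\<^sup>2 + 2 * c + d\<^sup>2)" for c d
      using assms
      by (simp add: inner_add_left inner_add_right inner_diff_left inner_diff_right
          inner_commute[of q p] inner_commute[of x p] inner_commute[of x q] norm_eq_1)
        (simp add: power2_eq_square algebra_simps)
    have "plane_rotation p q \<tau> x \<bullet> plane_rotation p q \<tau> x = x \<bullet> x +
        ((p \<bullet> x)\<^sup>2 + (q \<bullet> x)\<^sup>2) * ((cos \<tau> - 1)\<^sup>2 + 2 * (cos \<tau> - 1) + (sin \<tau>)\<^sup>2)"
      unfolding plane_rotation_def by (rule expand)
    also have "(cos \<tau> - 1)\<^sup>2 + 2 * (cos \<tau> - 1) + (sin \<tau>)\<^sup>2 = 0"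
      by (simp add: sin_squared_eq power2_eq_square algebra_simps)
    finally show ?thesis by simp
  qed
  then show "\<forall>x. norm (plane_rotation p q \<tau> x) = norm x"
    by (simp add: norm_eq_sqrt_inner)
qed

text \<open>The integral of \<open>x \<mapsto> (q \<bullet> x) a(p \<bullet> x)\<close> over the sphere does not
  change when x is rotated in the plane of p and q. The integrand below is the derivative of the
  rotated function at the angle 0, so its integral is 0; the derivative is bounded, uniformly in the
  angle, which justifies taking the limit of difference quotients under the integral.\<close>

lemma integral_sphere_rotation_derivative:
  fixes p q :: "'a::euclidean_space" and a a' :: "real \<Rightarrow> real"
  assumes pq: "norm p = 1" "norm q = 1" "p \<bullet> q = 0"
    and a: "\<And>s. (a has_real_derivative a' s) (at s)" and a': "continuous_on UNIV a'"
  shows "(\<integral>x. (p \<bullet> x) * a (p \<bullet> x) - (q \<bullet> x)\<^sup>2 * a' (p \<bullet> x) \<partial>sphere_measure) = 0"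
proof -
  have cont_a: "continuous_on UNIV a"
    using a DERIV_isCont by (auto simp: continuous_on_eq_continuous_at)
  \<comment> \<open>\<open>\<Psi> x \<tau>\<close> is the value of \<open>\<phi>\<close> at the rotated point, \<open>\<Psi>'\<close> its derivative in \<open>\<tau>\<close>\<close>
  define \<phi> where "\<phi> x = (q \<bullet> x) * a (p \<bullet> x)" for x
  have cont_\<phi>: "continuous_on UNIV \<phi>"
    unfolding \<phi>_def by (intro continuous_intros continuous_on_compose2[OF cont_a]) auto
  define \<Psi> where "\<Psi> x \<tau> = (cos \<tau> * (q \<bullet> x) + sin \<tau> * (p \<bullet> x)) * a (cos \<tau> * (p \<bullet> x) - sin \<tau> * (q \<bullet> x))" for x \<tau>
  define \<Psi>' where "\<Psi>' x \<tau> = (cos \<tau> * (p \<bullet> x) - sin \<tau> * (q \<bullet> x)) * a (cos \<tau> * (p \<bullet> x) - sin \<tau> * (q \<bullet> x))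
      - (cos \<tau> * (q \<bullet> x) + sin \<tau> * (p \<bullet> x))\<^sup>2 * a' (cos \<tau> * (p \<bullet> x) - sin \<tau> * (q \<bullet> x))" for x \<tau>
  have \<Psi>_eq: "\<Psi> x \<tau> = \<phi> (plane_rotation p q \<tau> x)" for x \<tau>
    by (simp add: \<Psi>_def \<phi>_def inner_plane_rotation[OF pq])
  have deriv_\<Psi>: "(\<Psi> x has_real_derivative \<Psi>' x \<tau>) (at \<tau>)" for x \<tau>
    unfolding \<Psi>_def \<Psi>'_def
    by (rule derivative_eq_intros DERIV_chain2[OF a] refl | simp)+
      (simp add: power2_eq_square algebra_simps)
  have cont_\<Psi>: "continuous_on UNIV (\<lambda>x. \<Psi> x \<tau>)" for \<tau>
    unfolding \<Psi>_def by (intro continuous_intros continuous_on_compose2[OF cont_a]) auto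
  have cont_\<Psi>': "continuous_on UNIV (\<lambda>x. \<Psi>' x \<tau>)" for \<tau>
    unfolding \<Psi>'_def
    by (intro continuous_intros continuous_on_compose2[OF cont_a] continuous_on_compose2[OF a']) auto
  have int_\<Psi>: "(\<integral>x. \<Psi> x \<tau> \<partial>sphere_measure) = (\<integral>x. \<phi> x \<partial>sphere_measure)" for \<tau>
    unfolding \<Psi>_eq using cont_\<phi>
    by (intro integral_sphere_measure_orthogonal orthogonal_plane_rotation pq
        borel_measurable_continuous_onI)
  \<comment> \<open>after a rotation, a and its derivative are evaluated at some \<open>cos \<tau> * s - sin \<tau> * y\<close> with s and y in [-1, 1]\<close>
  have "\<exists>M. \<forall>s\<in>{-2..2}. \<bar>a s\<bar> \<le> M \<and> \<bar>a' s\<bar> \<le> M"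
  proof -
    have "bounded (a ` {-2..2})" "bounded (a' ` {-2..2})"
      by (intro compact_imp_bounded compact_continuous_image continuous_on_subset[OF cont_a]
          continuous_on_subset[OF a']; simp)+
    then obtain M N where "\<And>s. s \<in> {-2..2} \<Longrightarrow> \<bar>a s\<bar> \<le> M" "\<And>s. s \<in> {-2..2} \<Longrightarrow> \<bar>a' s\<bar> \<le> N"
      unfolding bounded_iff by (metis imageI real_norm_def)
    then show ?thesis by (intro exI[of _ "max M N"]) (auto simp: le_max_iff_disj)
  qed
  then obtain M where M: "\<And>s. \<bar>s\<bar> \<le> 2 \<Longrightarrow> \<bar>a s\<bar> \<le> M" "\<And>s. \<bar>s\<bar> \<le> 2 \<Longrightarrow> \<bar>a' s\<bar> \<le> M"
    by (metis abs_le_iff atLeastAtMost_iff minus_le_iff)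
  have M0: "0 \<le> M" using M(1)[of 0] by simp
  have bound_\<Psi>': "\<bar>\<Psi>' x \<tau>\<bar> \<le> 2 * M + 2\<^sup>2 * M" if x: "norm x = 1" for x \<tau>
  proof -
    have "\<bar>p \<bullet> x\<bar> \<le> 1" "\<bar>q \<bullet> x\<bar> \<le> 1"
      using Cauchy_Schwarz_ineq2[of p x] Cauchy_Schwarz_ineq2[of q x] pq x by auto
    then have "\<bar>cos \<tau> * (p \<bullet> x)\<bar> \<le> 1 * 1" "\<bar>sin \<tau> * (p \<bullet> x)\<bar> \<le> 1 * 1"
      "\<bar>cos \<tau> * (q \<bullet> x)\<bar> \<le> 1 * 1" "\<bar>sin \<tau> * (q \<bullet> x)\<bar> \<le> 1 * 1"
      unfolding abs_mult by (intro mult_mono abs_cos_le_one abs_sin_le_one; simp)+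
    then have s: "\<bar>cos \<tau> * (p \<bullet> x) - sin \<tau> * (q \<bullet> x)\<bar> \<le> 2" and y: "\<bar>cos \<tau> * (q \<bullet> x) + sin \<tau> * (p \<bullet> x)\<bar> \<le> 2"
      by linarith+
    have "\<bar>\<Psi>' x \<tau>\<bar> \<le> \<bar>cos \<tau> * (p \<bullet> x) - sin \<tau> * (q \<bullet> x)\<bar> * \<bar>a (cos \<tau> * (p \<bullet> x) - sin \<tau> * (q \<bullet> x))\<bar>
      + \<bar>cos \<tau> * (q \<bullet> x) + sin \<tau> * (p \<bullet> x)\<bar>\<^sup>2 * \<bar>a' (cos \<tau> * (p \<bullet> x) - sin \<tau> * (q \<bullet> x))\<bar>"
      unfolding \<Psi>'_def abs_mult[symmetric] power_abs[symmetric] by (rule abs_triangle_ineq4)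
    also have "\<dots> \<le> 2 * M + 2\<^sup>2 * M"
      by (intro add_mono mult_mono power_mono M s y) (auto simp: M0)
    finally show ?thesis .
  qed
  define \<tau> where "\<tau> n = inverse (real (Suc n))" for n
  have \<tau>_pos: "\<tau> n > 0" for n by (simp add: \<tau>_def)
  have quot_lim: "(\<lambda>n. (\<Psi> x (\<tau> n) - \<Psi> x 0) / \<tau> n) \<longlonglongrightarrow> \<Psi>' x 0" for x
  proof -
    have "((\<lambda>h. (\<Psi> x (0 + h) - \<Psi> x 0) / h) \<longlongrightarrow> \<Psi>' x 0) (at 0)"
      using deriv_\<Psi>[of x 0] by (simp only: DERIV_def)
    moreover have "filterlim \<tau> (at 0) sequentially"
      unfolding filterlim_at using LIMSEQ_inverse_real_of_nat
      by (auto simp: \<tau>_def[abs_def])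
    ultimately have "(\<lambda>n. (\<Psi> x (0 + \<tau> n) - \<Psi> x 0) / \<tau> n) \<longlonglongrightarrow> \<Psi>' x 0"
      by (rule filterlim_compose)
    then show ?thesis by simp
  qed
  have quot_bound: "\<bar>(\<Psi> x (\<tau> n) - \<Psi> x 0) / \<tau> n\<bar> \<le> 2 * M + 2\<^sup>2 * M" if "norm x = 1" for x n
  proof -
    obtain z where "\<Psi> x (\<tau> n) - \<Psi> x 0 = (\<tau> n - 0) * \<Psi>' x z"
      using MVT2[OF \<tau>_pos, where f = "\<Psi> x" and f' = "\<Psi>' x"] deriv_\<Psi> by blast
    then show ?thesis
      using bound_\<Psi>'[OF that, of z] \<tau>_pos[of n] by simp
  qed
  have "(\<lambda>n. \<integral>x. (\<Psi> x (\<tau> n) - \<Psi> x 0) / \<tau> n \<partial>sphere_measure) \<longlonglongrightarrow> (\<integral>x. \<Psi>' x 0 \<partial>sphere_measure)"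
  proof (rule integral_dominated_convergence)
    show "(\<lambda>x. \<Psi>' x 0) \<in> borel_measurable sphere_measure"
      using cont_\<Psi>' by (intro borel_measurable_sphere_measure borel_measurable_continuous_onI)
    show "(\<lambda>x. (\<Psi> x (\<tau> n) - \<Psi> x 0) / \<tau> n) \<in> borel_measurable sphere_measure" for n
      using cont_\<Psi> by (intro borel_measurable_sphere_measure borel_measurable_continuous_onI)
        (auto intro!: continuous_intros simp: \<tau>_def)
    show "integrable sphere_measure (\<lambda>x. 2 * M + 2\<^sup>2 * M)"
      by (intro integrable_sphere_measure) simp
    show "AE x in sphere_measure. (\<lambda>n. (\<Psi> x (\<tau> n) - \<Psi> x 0) / \<tau> n) \<longlonglongrightarrow> \<Psi>' x 0"
      using quot_lim by simp
    show "AE x in sphere_measure. norm ((\<Psi> x (\<tau> n) - \<Psi> x 0) / \<tau> n) \<le> 2 * M + 2\<^sup>2 * M" for n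
      using quot_bound by (intro AE_I2) (simp add: space_sphere_measure)
  qed
  moreover have "(\<integral>x. (\<Psi> x (\<tau> n) - \<Psi> x 0) / \<tau> n \<partial>sphere_measure) = 0" for n
    using cont_\<Psi> by (simp add: integrable_sphere_measure int_\<Psi>)
  ultimately have "(\<lambda>n. 0) \<longlonglongrightarrow> (\<integral>x. \<Psi>' x 0 \<partial>sphere_measure)"
    by (simp only:)
  then have "(\<integral>x. \<Psi>' x 0 \<partial>sphere_measure) = 0"
    using LIMSEQ_const_iff by metis
  then show ?thesis unfolding \<Psi>'_def by simp
qed

lemma integral_sphere_rotation_derivative_orthogonal:
  fixes p q :: "'a::euclidean_space" and a a' :: "real \<Rightarrow> real"
  assumes p: "norm p = 1" and pq: "p \<bullet> q = 0"
    and a: "\<And>s. (a has_real_derivative a' s) (at s)" "continuous_on UNIV a'"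
  shows "(\<integral>x. (norm q)\<^sup>2 * ((p \<bullet> x) * a (p \<bullet> x)) - (q \<bullet> x)\<^sup>2 * a' (p \<bullet> x) \<partial>sphere_measure) = 0"
proof (cases "q = 0")
  case False
  have q: "q \<bullet> x = norm q * (sgn q \<bullet> x)" for x
    using False by (simp add: sgn_div_norm)
  have "(\<integral>x. (p \<bullet> x) * a (p \<bullet> x) - (sgn q \<bullet> x)\<^sup>2 * a' (p \<bullet> x) \<partial>sphere_measure) = 0"
    using False p pq a by (intro integral_sphere_rotation_derivative) (auto simp: norm_sgn sgn_div_norm)
  then have "(\<integral>x. (norm q)\<^sup>2 * ((p \<bullet> x) * a (p \<bullet> x) - (sgn q \<bullet> x)\<^sup>2 * a' (p \<bullet> x)) \<partial>sphere_measure) = 0"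
    by simp
  then show ?thesis
    by (simp add: q power_mult_distrib right_diff_distrib mult.assoc)
qed simp

text \<open>Summing the preceding identity over the components q of the standard basis vectors orthogonal to p
  gives \<open>\<Sum> norm(q)^2 = n - 1\<close> and, on the sphere,
  \<open>\<Sum> (q \<bullet> x)^2 = 1 - (p \<bullet> x)^2\<close>. The integrand below is the divergence on the
  sphere of the vector field \<open>a(p \<bullet> x)\<close> times the gradient of
  \<open>x \<mapsto> p \<bullet> x\<close>.\<close>

lemma integral_sphere_zonal_divergence:
  fixes p :: "'a::euclidean_space" and a a' :: "real \<Rightarrow> real"
  assumes p: "norm p = 1"
    and a: "\<And>s. (a has_real_derivative a' s) (at s)" and a': "continuous_on UNIV a'"
  shows "(\<integral>x. (1 - (p \<bullet> x)\<^sup>2) * a' (p \<bullet> x) - (real DIM('a) - 1) * (p \<bullet> x) * a (p \<bullet> x) \<partial>sphere_measure) = 0"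
proof -
  define q where "q b = b - (p \<bullet> b) *\<^sub>R p" for b
  define F where "F b x = (norm (q b))\<^sup>2 * ((p \<bullet> x) * a (p \<bullet> x)) - (q b \<bullet> x)\<^sup>2 * a' (p \<bullet> x)" for b x
  have cont_a: "continuous_on UNIV a"
    using a DERIV_isCont by (auto simp: continuous_on_eq_continuous_at)
  have pp: "p \<bullet> p = 1" using p by (simp add: norm_eq_1)
  have "integrable sphere_measure (F b)" for b
    unfolding F_def by (intro integrable_sphere_measure continuous_intros
        continuous_on_compose2[OF cont_a] continuous_on_compose2[OF a']) auto
  then have "(\<integral>x. (\<Sum>b\<in>Basis. F b x) \<partial>sphere_measure) = (\<Sum>b\<in>Basis. \<integral>x. F b x \<partial>sphere_measure)"
    by (intro Bochner_Integration.integral_sum)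
  also have "\<dots> = 0"
    unfolding F_def using p a a'
    by (intro sum.neutral ballI integral_sphere_rotation_derivative_orthogonal)
      (auto simp: q_def inner_diff_right pp)
  finally have "(\<integral>x. - (\<Sum>b\<in>Basis. F b x) \<partial>sphere_measure) = 0" by simp
  moreover have "- (\<Sum>b\<in>Basis. F b x) = (1 - (p \<bullet> x)\<^sup>2) * a' (p \<bullet> x) - (real DIM('a) - 1) * (p \<bullet> x) * a (p \<bullet> x)"
    if "norm x = 1" for x
  proof -
    have parseval: "(\<Sum>b\<in>Basis. (u \<bullet> b) * (v \<bullet> b)) = u \<bullet> v" for u v :: 'a
      by (simp add: euclidean_inner[symmetric])
    have "(norm (q b))\<^sup>2 = 1 - (p \<bullet> b) * (p \<bullet> b)" if "b \<in> Basis" for b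
      using that unfolding power2_norm_eq_inner q_def
      by (simp add: inner_diff_left inner_diff_right pp inner_commute[of b p])
    then have "(\<Sum>b\<in>Basis. (norm (q b))\<^sup>2) = (\<Sum>b\<in>(Basis :: 'a set). 1 - (p \<bullet> b) * (p \<bullet> b))"
      by (intro sum.cong) auto
    then have 1: "(\<Sum>b\<in>Basis. (norm (q b))\<^sup>2) = real DIM('a) - 1"
      by (simp add: sum_subtractf parseval pp)
    have "(q b \<bullet> x)\<^sup>2 = (x \<bullet> b) * (x \<bullet> b) - 2 * (p \<bullet> x) * ((p \<bullet> b) * (x \<bullet> b)) + (p \<bullet> x)\<^sup>2 * ((p \<bullet> b) * (p \<bullet> b))" for b
      unfolding q_def by (simp add: inner_diff_left inner_commute[of b x] power2_eq_square algebra_simps)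
    then have "(\<Sum>b\<in>Basis. (q b \<bullet> x)\<^sup>2) = x \<bullet> x - 2 * (p \<bullet> x) * (p \<bullet> x) + (p \<bullet> x)\<^sup>2 * (p \<bullet> p)"
      by (simp add: sum.distrib sum_subtractf parseval flip: sum_distrib_left)
    then have 2: "(\<Sum>b\<in>Basis. (q b \<bullet> x)\<^sup>2) = 1 - (p \<bullet> x)\<^sup>2"
      using that by (simp add: pp norm_eq_1 power2_eq_square)
    show ?thesis
      unfolding F_def sum_subtractf sum_distrib_right[symmetric] 1 2 by simp
  qed
  ultimately show ?thesis
    by (subst (asm) Bochner_Integration.integral_cong[OF refl]) (auto simp: space_sphere_measure)
qed

text \<open>Up to a constant factor, \<open>(1 - s^2)^k\<close> is the density of \<open>p \<bullet> x\<close> on the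
  sphere, so the hypotheses say that the integral of h against this density is 0. No density has to be
  computed: \<open>a = P / (1 - s^2)^(k+1)\<close> solves \<open>(1 - s^2) a' - (2 k + 2) s a = h\<close>,
  which makes \<open>h(p \<bullet> x)\<close> a divergence. As P vanishes near -1 and 1, so does a, and the
  singularity of the quotient is harmless.\<close>

lemma integral_sphere_zonal_eq_0:
  fixes p :: "'a::euclidean_space" and h P :: "real \<Rightarrow> real"
  assumes dim: "DIM('a) = 2 * k + 3" and p: "norm p = 1"
    and h: "continuous_on UNIV h" "\<And>s. s \<notin> {s0..s1} \<Longrightarrow> h s = 0"
    and P: "\<And>s. (P has_real_derivative h s * (1 - s\<^sup>2) ^ k) (at s)" "\<And>s. s \<notin> {s0..s1} \<Longrightarrow> P s = 0"
    and s01: "-1 < s0" "s1 < 1"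
  shows "(\<integral>x. h (p \<bullet> x) \<partial>sphere_measure) = 0"
proof -
  define a where "a s = P s / (1 - s\<^sup>2) ^ Suc k" for s
  define a' where "a' s = h s / (1 - s\<^sup>2) + 2 * real (Suc k) * s * P s / (1 - s\<^sup>2) ^ Suc (Suc k)" for s
  have zero: "a s = 0" "a' s = 0" if "s \<notin> {s0..s1}" for s
    using that h(2) P(2) by (simp_all add: a_def a'_def)
  have cover: "{-1<..<1} \<union> - {s0..s1} = UNIV"
    using s01 by auto
  have deriv_a: "(a has_real_derivative a' s) (at s)" for s
  proof (cases "s \<in> {s0..s1}")
    case True
    then have "\<bar>s\<bar> < 1" using s01 by auto
    then have "1 - s\<^sup>2 > 0" by (simp add: abs_square_less_1)
    then have w: "1 - s\<^sup>2 \<noteq> 0" by simp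
    have "((\<lambda>s. 1 - s\<^sup>2) has_real_derivative - 2 * s) (at s)"
      by (auto intro!: derivative_eq_intros)
    from DERIV_divide[OF P(1) DERIV_power_Suc[OF this] power_not_zero[OF w]]
    have "(a has_real_derivative (h s * (1 - s\<^sup>2) ^ k * (1 - s\<^sup>2) ^ Suc k -
        P s * ((1 + real k) * (- 2 * s * (1 - s\<^sup>2) ^ k))) / ((1 - s\<^sup>2) ^ Suc k * (1 - s\<^sup>2) ^ Suc k)) (at s)"
      unfolding a_def[abs_def] .
    note d = this
    have cancel: "(h s * W * (w * W) - P s * ((1 + real k) * (- 2 * s * W))) / ((w * W) * (w * W)) =
        h s / w + 2 * real (Suc k) * s * P s / (w * (w * W))" if "w \<noteq> 0" "W \<noteq> 0" for w W
      using that by (simp add: field_simps)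
    have e: "(h s * (1 - s\<^sup>2) ^ k * (1 - s\<^sup>2) ^ Suc k -
        P s * ((1 + real k) * (- 2 * s * (1 - s\<^sup>2) ^ k))) / ((1 - s\<^sup>2) ^ Suc k * (1 - s\<^sup>2) ^ Suc k) = a' s"
      unfolding a'_def power_Suc by (rule cancel[OF w power_not_zero[OF w]])
    show ?thesis using d unfolding e .
  next
    case False
    have "(a has_real_derivative 0) (at s)"
      by (rule has_field_derivative_transform_within_open[of "\<lambda>_. 0" _ _ "- {s0..s1}"])
        (use False zero in auto)
    then show ?thesis using zero(2)[OF False] by simp
  qed
  have cont_P: "continuous_on UNIV P"
    using P(1) DERIV_isCont by (auto simp: continuous_on_eq_continuous_at)
  have "1 - s\<^sup>2 \<noteq> 0" if "s \<in> {-1<..<1}" for s :: real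
    using that abs_square_less_1[of s] by auto
  then have "continuous_on {-1<..<1} a'"
    unfolding a'_def
    by (intro continuous_intros continuous_on_subset[OF h(1)] continuous_on_subset[OF cont_P]) auto
  moreover have "continuous_on (- {s0..s1}) a'"
    by (rule continuous_on_eq[OF continuous_on_const[of _ 0]]) (simp add: zero)
  ultimately have cont_a': "continuous_on UNIV a'"
    using continuous_on_open_Un[of "{-1<..<1}" "- {s0..s1}" a'] unfolding cover
    by (simp add: open_Compl)
  have h_eq: "h s = (1 - s\<^sup>2) * a' s - (real DIM('a) - 1) * s * a s" for s
  proof (cases "s \<in> {s0..s1}")
    case True
    then have "\<bar>s\<bar> < 1" using s01 by auto
    then have "1 - s\<^sup>2 > 0" by (simp add: abs_square_less_1)
    then have w: "1 - s\<^sup>2 \<noteq> 0" by simp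
    have "h s = w * (h s / w + 2 * real (Suc k) * s * P s / (w * (w * W))) - 2 * real (Suc k) * s * (P s / (w * W))"
      if "w \<noteq> 0" "W \<noteq> 0" for w W
      using that by (simp add: field_simps)
    moreover have "real DIM('a) - 1 = 2 * real (Suc k)" by (simp add: dim)
    ultimately show ?thesis
      unfolding a_def a'_def power_Suc using w power_not_zero[OF w, of k] by (simp only:)
  next
    case False
    then show ?thesis by (simp add: zero h(2))
  qed
  show ?thesis
    unfolding h_eq by (rule integral_sphere_zonal_divergence[OF p deriv_a cont_a'])
qed

section \<open>Interior non-uniqueness for the spherical mean transform\<close>

text \<open>On the sphere of radius t about p one has \<open>norm(p + t x)^2 = 1 + t^2 + 2 t s\<close> with
  \<open>s = p \<bullet> x\<close>, which runs through the whole support of g as s runs through a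
  compact part of (-1, 1). The weight \<open>(1 - s^2)^k\<close> is a polynomial of degree 2 k in this
  quantity, so the derivative of order 2 k + 1 is orthogonal to it.\<close>

lemma spherical_mean_radial_eq_0:
  fixes p :: "'a::euclidean_space" and g :: "real \<Rightarrow> real"
  assumes dim: "DIM('a) = 2 * k + 3" and p: "norm p = 1" and t: "t > 0" "(1 - t)\<^sup>2 < \<alpha>" "\<beta> < (1 + t)\<^sup>2"
    and g: "smooth_on UNIV g" "\<forall>v. v \<notin> {\<alpha>..\<beta>} \<longrightarrow> g v = 0"
  shows "spherical_mean (\<lambda>x. (deriv ^^ (2 * k + 1)) g ((norm x)\<^sup>2)) p t = 0"
proof -
  define G where "G = (deriv ^^ (2 * k + 1)) g"
  \<comment> \<open>the affine polynomial that recovers s from \<open>v = 1 + t^2 + 2 t s\<close>\<close>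
  define l where "l = [: - (1 + t\<^sup>2) / (2 * t), 1 / (2 * t) :]"
  have l: "poly l (1 + t\<^sup>2 + 2 * t * s) = s" for s
    using t(1) by (simp add: l_def field_simps)
  define Q where "Q = (1 - l\<^sup>2) ^ k"
  have "degree (1 - l\<^sup>2) \<le> 2"
    by (intro degree_diff_le order.trans[OF degree_power_le]) (auto simp: l_def)
  then have "degree Q \<le> 2 * k"
    unfolding Q_def by (intro order.trans[OF degree_power_le]) simp
  then have "(pderiv ^^ (2 * k + 1)) Q = 0"
    by (intro higher_pderiv_eq_0) simp
  from ex_antiderivative_poly_times_higher_deriv[OF g this] obtain P where
    P: "\<And>v. (P has_real_derivative poly Q v * G v) (at v)" "\<And>v. v \<notin> {\<alpha>..\<beta>} \<Longrightarrow> P v = 0"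
    by (auto simp: G_def)
  define s0 s1 where "s0 = (\<alpha> - 1 - t\<^sup>2) / (2 * t)" and "s1 = (\<beta> - 1 - t\<^sup>2) / (2 * t)"
  have outside: "1 + t\<^sup>2 + 2 * t * s \<notin> {\<alpha>..\<beta>}" if "s \<notin> {s0..s1}" for s
    using that t(1) by (auto simp: s0_def s1_def field_simps)
  have "(\<integral>x. G (1 + t\<^sup>2 + 2 * t * (p \<bullet> x)) \<partial>sphere_measure) = 0"
  proof (rule integral_sphere_zonal_eq_0[OF dim p,
        where h = "\<lambda>s. G (1 + t\<^sup>2 + 2 * t * s)" and P = "\<lambda>s. P (1 + t\<^sup>2 + 2 * t * s) / (2 * t)"])
    have "continuous_on UNIV G"
      unfolding G_def by (rule smooth_on_continuous[OF smooth_on_higher_deriv[OF g(1)]])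
    then show "continuous_on UNIV (\<lambda>s. G (1 + t\<^sup>2 + 2 * t * s))"
      by (rule continuous_on_compose2) (auto intro!: continuous_intros)
    show "G (1 + t\<^sup>2 + 2 * t * s) = 0" if "s \<notin> {s0..s1}" for s
      unfolding G_def by (rule higher_deriv_eq_0_outside[OF g(2) outside[OF that]])
    show "P (1 + t\<^sup>2 + 2 * t * s) / (2 * t) = 0" if "s \<notin> {s0..s1}" for s
      using P(2)[OF outside[OF that]] by simp
    show "((\<lambda>s. P (1 + t\<^sup>2 + 2 * t * s) / (2 * t)) has_real_derivative
        G (1 + t\<^sup>2 + 2 * t * s) * (1 - s\<^sup>2) ^ k) (at s)" for s
      using t(1) by (auto intro!: derivative_eq_intros DERIV_chain2[OF P(1)] simp: Q_def l)
    show "-1 < s0" "s1 < 1"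
      using t by (auto simp: s0_def s1_def field_simps power2_eq_square)
  qed
  moreover have "(norm (p + t *\<^sub>R x))\<^sup>2 = 1 + t\<^sup>2 + 2 * t * (p \<bullet> x)" if "norm x = 1" for x
    using p that unfolding power2_norm_eq_inner norm_eq_1
    by (simp add: inner_add_left inner_add_right inner_commute[of x p] power2_eq_square distrib_left)
  then have "(\<integral>x. G ((norm (p + t *\<^sub>R x))\<^sup>2) \<partial>sphere_measure) = (\<integral>x. G (1 + t\<^sup>2 + 2 * t * (p \<bullet> x)) \<partial>sphere_measure)"
    by (intro Bochner_Integration.integral_cong) (auto simp: space_sphere_measure)
  ultimately have "(\<integral>x. G ((norm (p + t *\<^sub>R x))\<^sup>2) \<partial>sphere_measure) = 0"
    by (simp only:)
  then show ?thesis
    unfolding spherical_mean_def G_def by (simp only: mult_zero_right)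
qed

theorem corollary1p7:
  fixes U :: "(real ^ 'n) set"
  assumes "odd CARD('n)" and "CARD('n) \<ge> 3"
    and "open U" and "closure U \<subseteq> ball 0 1"
  shows "\<exists>f \<in> test_functions (ball (0 :: real ^ 'n) 1).
    f \<noteq> (\<lambda>x. 0) \<and> (\<forall>x\<in>U. f x = 0) \<and>
    (\<forall>p \<in> sphere 0 1. \<forall>t > 0. {x. norm (x - p) = t} \<inter> U \<noteq> {} \<longrightarrow> spherical_mean f p t = 0)"
proof -
  obtain m where m: "CARD('n) = 2 * m + 1"
    using assms(1) by (rule oddE)
  define k where "k = m - 1"
  have "CARD('n) = 2 * k + 3"
    using m assms(2) unfolding k_def by linarith
  then have dim: "DIM(real ^ 'n) = 2 * k + 3" by simp
  have "compact (closure U)"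
    using assms(4) by (meson bounded_ball bounded_subset closed_closure compact_eq_bounded_closed)
  then have "\<exists>r\<ge>0. r < 1 \<and> (\<forall>x\<in>U. norm x \<le> r)"
  proof (cases "U = {}")
    case False
    have "continuous_on (closure U) norm" by (intro continuous_intros)
    then obtain z where "z \<in> closure U" "\<forall>x\<in>closure U. norm x \<le> norm z"
      using continuous_attains_sup[OF \<open>compact (closure U)\<close>] False by auto
    then show ?thesis
      using assms(4) closure_subset by (intro exI[of _ "norm z"]) auto
  qed (auto intro: exI[of _ 0])
  then obtain r where r: "0 \<le> r" "r < 1" "\<And>x. x \<in> U \<Longrightarrow> norm x \<le> r" by blast
  have "r\<^sup>2 < 1" using r by (simp add: abs_square_less_1)
  \<comment> \<open>bounds for \<open>norm(x)^2\<close> on the support of f; strict inequalities keep f away from U and from the unit sphere, and s away from -1 and 1\<close>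
  then obtain \<alpha> \<beta> where \<alpha>\<beta>: "r\<^sup>2 < \<alpha>" "\<alpha> < \<beta>" "\<beta> < 1"
    by (meson dense)
  obtain g where g: "smooth_on UNIV g" "\<forall>v. v \<notin> {\<alpha>..\<beta>} \<longrightarrow> g v = 0" "g \<noteq> (\<lambda>v::real. 0)"
    using ex_smooth_bump[OF \<open>\<alpha> < \<beta>\<close>] by blast
  define G where "G = (deriv ^^ (2 * k + 1)) g"
  have G: "smooth_on UNIV G" "\<forall>v. v \<notin> {\<alpha>..\<beta>} \<longrightarrow> G v = 0" "G \<noteq> (\<lambda>v. 0)"
    unfolding G_def
    using smooth_on_higher_deriv[OF g(1)] higher_deriv_eq_0_outside[OF g(2)] higher_deriv_nonzero[OF g]
    by blast+
  show ?thesis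
  proof (intro bexI[of _ "\<lambda>x. G ((norm x)\<^sup>2)"] conjI ballI allI impI)
    show "(\<lambda>x. G ((norm x)\<^sup>2)) \<in> test_functions (ball (0 :: real ^ 'n) 1)"
      using radial_test_function[OF G(1,2) \<alpha>\<beta>(3)] .
    obtain v where v: "G v \<noteq> 0" using G(3) by auto
    then have "v \<in> {\<alpha>..\<beta>}" using G(2) by blast
    then have "v \<ge> 0" using \<alpha>\<beta>(1) zero_le_power2[of r] unfolding atLeastAtMost_iff by linarith
    obtain x :: "real ^ 'n" where "norm x = sqrt v"
      using \<open>v \<ge> 0\<close> vector_choose_size by (metis real_sqrt_ge_zero)
    then have "G ((norm x)\<^sup>2) \<noteq> 0" using v \<open>v \<ge> 0\<close> by simp
    then show "(\<lambda>x::real^'n. G ((norm x)\<^sup>2)) \<noteq> (\<lambda>x. 0)" by meson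
    show "G ((norm x)\<^sup>2) = 0" if "x \<in> U" for x
    proof -
      have "(norm x)\<^sup>2 \<le> r\<^sup>2" using r(3)[OF that] by (simp add: power_mono)
      then show ?thesis using \<alpha>\<beta>(1) G(2) by auto
    qed
    fix p :: "real ^ 'n" and t :: real
    assume p: "p \<in> sphere 0 1" and t: "t > 0" and "{x. norm (x - p) = t} \<inter> U \<noteq> {}"
    then obtain x where x: "x \<in> U" "norm (x - p) = t" by blast
    \<comment> \<open>so the means about p of radius t see the whole interval from \<open>r^2\<close> to 1\<close>
    have "\<bar>1 - t\<bar> \<le> norm x"
      using p x(2) norm_triangle_ineq3[of p "p - x"] by (simp add: norm_minus_commute)
    then have "\<bar>1 - t\<bar> \<le> r" using r(3)[OF x(1)] by simp
    then have "(1 - t)\<^sup>2 \<le> r\<^sup>2" by (metis abs_ge_zero power2_abs power_mono)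
    then have lower: "(1 - t)\<^sup>2 < \<alpha>" using \<alpha>\<beta>(1) by linarith
    have "1 < (1 + t)\<^sup>2" using t by (simp add: one_less_power)
    then have upper: "\<beta> < (1 + t)\<^sup>2" using \<alpha>\<beta>(3) by linarith
    have "norm p = 1" using p by simp
    then show "spherical_mean (\<lambda>x. G ((norm x)\<^sup>2)) p t = 0"
      unfolding G_def by (rule spherical_mean_radial_eq_0[OF dim _ t lower upper g(1,2)])
  qed
qed

end
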